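(* Let $G$ be a mixed graph on $n$ vertices. Then $\boldsymbol{\nu}_{2n-1}(G)\leq\frac{2a(G)}{n}\leq\boldsymbol{\nu}_1(G)$, where $\boldsymbol{\nu}_1(G)\ge\cdots\ge\boldsymbol{\nu}_{2n}(G)$ are the eigenvalues of the integrated Laplacian matrix of $G$.
   Context: A mixed graph $G=(V_G,E_G,\vec{E}_G)$ has a finite vertex set, a multiset $E_G$ of unordered pairs (edges; $\{v,v\}$ is a loop) and a multiset $\vec{E}_G$ of ordered pairs (arcs; $(v,v)$ is a directed loop). $a(G)$ is the number of arcs including directed loops. $d(v)$ is the number of edges at $v$ with loops counted twice; $d^+(v)$ (resp. $d^-(v)$) is the number of arcs starting (resp. ending) at $v$, directed loops included. For $V_G=\{v_1,\dots,v_n\}$, the integrated adjacency matrix $\mathcal{I}(G)$ is the $2n\times 2n$ matrix indexed by $v'_1,\dots,v'_n,v''_1,\dots,v''_n$ whose $(v'_i,v'_j)$ and $(v''_i,v''_j)$ entries are the number of edges joining $v_i,v_j$ if $i\ne j$ and $2\times$(number of loops at $v_i$) if $i=j$, and whose $(v'_i,v''_j)$ and $(v''_j,v'_i)$ entries are the number of arcs from $v_i$ to $v_j$. The integrated degree matrix $\mathcal{I}^D(G)$ is diagonal with $(v'_i,v'_i)$ entry $d(v_i)+d^+(v_i)$ and $(v''_i,v''_i)$ entry $d(v_i)+d^-(v_i)$; the integrated Laplacian matrix is $\mathcal{I}^L(G)=\mathcal{I}^D(G)-\mathcal{I}(G)$. *)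

theory Defs
  imports
    "HOL-Library.Uprod"
    "HOL-Library.Multiset"
    "HOL-Computational_Algebra.Polynomial_Factorial"
    "Jordan_Normal_Form.Char_Poly"
begin

text \<open>An edge is an unordered pair and may be degenerate: \<open>Upair v v\<close> is a loop.
  An arc \<open>(u, v)\<close> starts at \<open>u\<close> and ends at \<open>v\<close>; \<open>(v, v)\<close> is a directed loop.\<close>

record 'v mixed_graph =
  vertices :: "'v set"
  edges :: "'v uprod multiset"
  arcs :: "('v \<times> 'v) multiset"

definition is_mixed_graph :: "'v mixed_graph \<Rightarrow> bool" where
  "is_mixed_graph G \<longleftrightarrow>
     finite (vertices G) \<and>
     (\<forall>e \<in># edges G. set_uprod e \<subseteq> vertices G) \<and>
     (\<forall>(u, v) \<in># arcs G. u \<in> vertices G \<and> v \<in> vertices G)"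

definition num_arcs :: "'v mixed_graph \<Rightarrow> nat" where
  "num_arcs G = size (arcs G)"

text \<open>The first summand counts each loop at \<open>v\<close> once, the second counts it once more.\<close>

definition degree_edges :: "'v mixed_graph \<Rightarrow> 'v \<Rightarrow> nat" where
  "degree_edges G v =
     size {#e \<in># edges G. v \<in> set_uprod e#} + count (edges G) (Upair v v)"

definition outdegree :: "'v mixed_graph \<Rightarrow> 'v \<Rightarrow> nat" where
  "outdegree G v = size {#e \<in># arcs G. fst e = v#}"

definition indegree :: "'v mixed_graph \<Rightarrow> 'v \<Rightarrow> nat" where
  "indegree G v = size {#e \<in># arcs G. snd e = v#}"

text \<open>In the matrices below, \<open>vs = [v\<^sub>1, \<dots>, v\<^sub>n]\<close> enumerates the vertices. Rows and columns
  \<open>0, \<dots>, n - 1\<close> belong to \<open>v'\<^sub>1, \<dots>, v'\<^sub>n\<close>, and \<open>n, \<dots>, 2n - 1\<close> to \<open>v''\<^sub>1, \<dots>, v''\<^sub>n\<close>.\<close>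

definition edge_matrix :: "'v mixed_graph \<Rightarrow> 'v list \<Rightarrow> real mat" where
  "edge_matrix G vs = mat (length vs) (length vs) (\<lambda>(i, j).
     if i = j then 2 * real (count (edges G) (Upair (vs ! i) (vs ! i)))
     else real (count (edges G) (Upair (vs ! i) (vs ! j))))"

definition arc_matrix :: "'v mixed_graph \<Rightarrow> 'v list \<Rightarrow> real mat" where
  "arc_matrix G vs = mat (length vs) (length vs) (\<lambda>(i, j).
     real (count (arcs G) (vs ! i, vs ! j)))"

text \<open>The lower left block is transposed: its \<open>(v''\<^sub>j, v'\<^sub>i)\<close> entry, like the \<open>(v'\<^sub>i, v''\<^sub>j)\<close> entry,
  is the number of arcs from \<open>v\<^sub>i\<close> to \<open>v\<^sub>j\<close>.\<close>

definition integrated_adjacency :: "'v mixed_graph \<Rightarrow> 'v list \<Rightarrow> real mat" where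
  "integrated_adjacency G vs =
     four_block_mat (edge_matrix G vs) (arc_matrix G vs)
                    (transpose_mat (arc_matrix G vs)) (edge_matrix G vs)"

definition integrated_degree :: "'v mixed_graph \<Rightarrow> 'v list \<Rightarrow> real mat" where
  "integrated_degree G vs =
     (let n = length vs in
      four_block_mat
        (mat_diag n (\<lambda>i. real (degree_edges G (vs ! i) + outdegree G (vs ! i)))) (0\<^sub>m n n)
        (0\<^sub>m n n) (mat_diag n (\<lambda>i. real (degree_edges G (vs ! i) + indegree G (vs ! i)))))"

definition integrated_laplacian :: "'v mixed_graph \<Rightarrow> 'v list \<Rightarrow> real mat" where
  "integrated_laplacian G vs = integrated_degree G vs - integrated_adjacency G vs"

text \<open>Eigenvalues are listed in decreasing order and repeated according to algebraic multiplicity.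
  Only real eigenvalues are listed, which for a symmetric matrix is all of them. The index \<open>k\<close>
  of \<open>nth_eigenvalue\<close> starts at 1.\<close>

definition eigenvalues_desc :: "real mat \<Rightarrow> real list" where
  "eigenvalues_desc A = rev (sorted_list_of_multiset (proots (char_poly A)))"

definition nth_eigenvalue :: "real mat \<Rightarrow> nat \<Rightarrow> real" where
  "nth_eigenvalue A k = eigenvalues_desc A ! (k - 1)"

definition laplacian_eigenvalue :: "'v mixed_graph \<Rightarrow> 'v list \<Rightarrow> nat \<Rightarrow> real" where
  "laplacian_eigenvalue G vs k = nth_eigenvalue (integrated_laplacian G vs) k"

end

(* Let z be the all-ones vector and let y be 1 on the v' and -1 on the v''. The integrated
   Laplacian L annihilates z, and y is orthogonal to z with y . L y = 4 a(G) and y . y = 2n, so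
   the Rayleigh quotient of y is R = 2 a(G) / n, whence nu_1 >= R. On span {z, y} the Rayleigh
   quotient is at most R because R >= 0, and this plane contains a nonzero vector orthogonal to a
   unit eigenvector of nu_2n, on which the Rayleigh quotient is at least nu_{2n-1}. *)

theory Submission
  imports Defs "Jordan_Normal_Form.Schur_Decomposition"
begin

section \<open>Orthogonal diagonalization of real symmetric matrices\<close>

lemma conjugate_real_vec [simp]: "conjugate (v :: real vec) = v"
  by (rule eq_vecI) (auto simp: conjugate_vec_def)

text \<open>For a complex eigenvector \<open>v\<close>, the Hermitian form of \<open>A\<close> at
  \<open>v\<close> equals \<open>a\<close> times the squared norm of \<open>v\<close>. Since
  \<open>A\<close> is real and symmetric, this form is its own conjugate, so \<open>a\<close> is a
  quotient of two reals.\<close>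

lemma symmetric_eigenvalue_real:
  fixes A :: "real mat"
  assumes A: "A \<in> carrier_mat n n" and sym: "transpose_mat A = A"
    and ev: "eigenvalue (map_mat complex_of_real A) a"
  shows "a \<in> \<real>"
proof -
  let ?A = "map_mat complex_of_real A"
  obtain v where v: "v \<in> carrier_vec n" "v \<noteq> 0\<^sub>v n" "?A *\<^sub>v v = a \<cdot>\<^sub>v v"
    using ev A unfolding eigenvalue_def eigenvector_def by auto
  have Aij: "A $$ (i,j) = A $$ (j,i)" if "i < n" "j < n" for i j
    using sym that A by (metis carrier_matD index_transpose_mat(1))
  define s where "s = (\<Sum>i<n. \<Sum>j<n. of_real (A $$ (i,j)) * v $ j * cnj (v $ i))"
  define q where "q = (\<Sum>i<n. (norm (v $ i))\<^sup>2)"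
  have row: "(\<Sum>j<n. of_real (A $$ (i,j)) * v $ j) = a * v $ i" if "i < n" for i
  proof -
    have "(?A *\<^sub>v v) $ i = (a \<cdot>\<^sub>v v) $ i" using v(3) by simp
    thus ?thesis using that A v(1) by (simp add: scalar_prod_def atLeast0LessThan)
  qed
  have "s = (\<Sum>i<n. a * v $ i * cnj (v $ i))"
    unfolding s_def by (intro sum.cong refl) (simp add: row sum_distrib_right [symmetric])
  also have "\<dots> = a * of_real q"
    unfolding q_def by (simp add: sum_distrib_left mult.assoc complex_norm_square [symmetric] flip: of_real_power)
  finally have s: "s = a * of_real q" .
  have "cnj s = (\<Sum>i<n. \<Sum>j<n. of_real (A $$ (i,j)) * cnj (v $ j) * v $ i)"
    by (simp add: s_def)
  \<comment> \<open>Exchanging the summations interchanges the roles of \<open>i\<close> and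
    \<open>j\<close>; symmetry of \<open>A\<close> then turns the conjugate of \<open>s\<close> back
    into \<open>s\<close>.\<close>
  also have "\<dots> = (\<Sum>j<n. \<Sum>i<n. of_real (A $$ (i,j)) * cnj (v $ j) * v $ i)"
    by (rule sum.swap)
  also have "\<dots> = s"
    unfolding s_def by (intro sum.cong refl) (simp add: Aij mult_ac)
  finally have "s \<in> \<real>" by (simp add: Reals_cnj_iff)
  obtain k where k: "k < n" "v $ k \<noteq> 0"
    using v(1,2) by (metis carrier_vecD eq_vecI index_zero_vec)
  have "0 < q" unfolding q_def
    by (rule sum_pos2[of _ k]) (use k in auto)
  hence "a = s / of_real q" using s by simp
  thus ?thesis using \<open>s \<in> \<real>\<close> by simp
qed

text \<open>The characteristic polynomial splits over the complex numbers and all its roots are real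
  eigenvalues. The factorization descends to the reals because the embedding of real polynomials
  into complex ones is injective.\<close>

lemma char_poly_symmetric_splits:
  fixes A :: "real mat"
  assumes A: "A \<in> carrier_mat n n" and sym: "transpose_mat A = A"
  shows "\<exists>es. char_poly A = (\<Prod>e\<leftarrow>es. [:- e, 1:]) \<and> length es = n"
proof -
  let ?A = "map_mat complex_of_real A"
  have cA: "?A \<in> carrier_mat n n" using A by simp
  obtain as where as: "char_poly ?A = (\<Prod>a\<leftarrow>as. [:- a, 1:])" "length as = n"
    using char_poly_factorized[OF cA] by auto
  have "a \<in> \<real>" if "a \<in> set as" for a
  proof (rule symmetric_eigenvalue_real[OF A sym])
    have "poly (char_poly ?A) a = 0"
      using that unfolding as(1) by (simp add: poly_prod_list prod_list_zero_iff image_iff o_def)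
    thus "eigenvalue ?A a" using eigenvalue_root_char_poly[OF cA] by blast
  qed
  \<comment> \<open>Each root is the embedding of its real part, so \<open>map Re as\<close> serves
    as the real list of roots.\<close>
  hence real: "map (complex_of_real \<circ> Re) as = as"
    by (intro map_idI) auto
  interpret h: map_poly_inj_idom_hom complex_of_real ..
  have "map_poly complex_of_real (char_poly A) = char_poly ?A"
    by (rule of_real_hom.char_poly_hom[OF A, symmetric])
  also have "\<dots> = (\<Prod>a\<leftarrow>map (complex_of_real \<circ> Re) as. [:- a, 1:])"
    unfolding real as(1) ..
  also have "\<dots> = map_poly complex_of_real (\<Prod>e\<leftarrow>map Re as. [:- e, 1:])"
    by (simp add: h.hom_prod_list o_def)
  finally have "char_poly A = (\<Prod>e\<leftarrow>map Re as. [:- e, 1:])" by (simp add: h.injectivity)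
  thus ?thesis using as(2) by (intro exI[of _ "map Re as"]) simp
qed

text \<open>Gram-Schmidt, applied to a basis that starts with \<open>v\<close>, leaves
  \<open>v\<close> in first place. Normalizing the resulting vectors gives the columns of
  \<open>W\<close>, so \<open>c\<close> is the reciprocal of the norm of \<open>v\<close>.\<close>

lemma orthogonal_completion:
  fixes v :: "real vec"
  assumes v: "v \<in> carrier_vec n" and v0: "v \<noteq> 0\<^sub>v n"
  shows "\<exists>W c. W \<in> carrier_mat n n \<and> transpose_mat W * W = 1\<^sub>m n \<and> col W 0 = c \<cdot>\<^sub>v v"
proof -
  interpret cof_vec_space n "TYPE(real)" .
  define b where "b = basis_completion v"
  define ws where "ws = gram_schmidt n b"
  note bc = basis_completion[OF v v0, folded b_def]
  have n: "n \<noteq> 0" using v v0 by (metis carrier_vecD eq_vecI index_zero_vec(2) not_less_zero)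
  obtain vs where bv: "b = v # vs" using bc(6,7) n by (cases b) auto
  have ws: "set ws \<subseteq> carrier_vec n" "corthogonal ws" "length ws = n"
    using gram_schmidt_result[OF bc(2,4,5) ws_def] bc(6) by auto
  have "hd ws = v" unfolding ws_def bv by (rule gram_schmidt_hd[OF v])
  hence ws0: "ws ! 0 = v" using n ws(3) by (metis hd_conv_nth list.size(3))
  have wsc: "ws ! i \<in> carrier_vec n" if "i < n" for i using ws that by auto
  have orth: "(ws ! i \<bullet> ws ! j = 0) = (i \<noteq> j)" if "i < n" "j < n" for i j
    using corthogonalD[OF ws(2)] that ws(3) by simp
  define N where "N i = sqrt (ws ! i \<bullet> ws ! i)" for i
  define W where "W = mat_of_cols n (map (\<lambda>w. (1 / sqrt (w \<bullet> w)) \<cdot>\<^sub>v w) ws)"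
  have colW: "col W i = (1 / N i) \<cdot>\<^sub>v (ws ! i)" if "i < n" for i
    unfolding W_def N_def using that ws(3) wsc by (subst col_mat_of_cols) auto
  have W: "W \<in> carrier_mat n n" unfolding W_def using ws(3) by (auto simp: mat_of_cols_def)
  have "transpose_mat W * W = 1\<^sub>m n"
  proof (rule eq_matI)
    fix i j assume "i < dim_row (1\<^sub>m n :: real mat)" "j < dim_col (1\<^sub>m n :: real mat)"
    hence ij: "i < n" "j < n" by auto
    have "(transpose_mat W * W) $$ (i,j) = col W i \<bullet> col W j"
      using W ij by simp
    also have "\<dots> = (ws ! i \<bullet> ws ! j) / (N i * N j)"
      using wsc[OF ij(1)] wsc[OF ij(2)] by (simp add: colW ij)
    also have "\<dots> = (if i = j then 1 else 0)"
    proof (cases "i = j")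
      case True
      have "0 \<le> ws ! i \<bullet> ws ! i" by (simp add: scalar_prod_def sum_nonneg)
      thus ?thesis using True orth[OF ij] by (simp add: N_def)
    qed (use orth[OF ij] in auto)
    finally show "(transpose_mat W * W) $$ (i,j) = 1\<^sub>m n $$ (i,j)" using ij by simp
  qed (use W in auto)
  moreover have "col W 0 = (1 / N 0) \<cdot>\<^sub>v v" using colW[of 0] n ws0 by simp
  ultimately show ?thesis using W by blast
qed

text \<open>Deflation: in an orthonormal basis that starts with an eigenvector for \<open>e\<close>,
  the matrix becomes block diagonal with \<open>e\<close> in the corner, and the induction
  hypothesis handles the remaining symmetric block. The order of \<open>es\<close> is arbitrary, so
  the diagonal can later be taken in decreasing order.\<close>

theorem symmetric_diagonalization:
  fixes A :: "real mat"
  assumes "A \<in> carrier_mat n n" "transpose_mat A = A"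
    and "char_poly A = (\<Prod>e\<leftarrow>es. [:- e, 1:])" "length es = n"
  shows "\<exists>U \<in> carrier_mat n n. transpose_mat U * U = 1\<^sub>m n \<and>
           transpose_mat U * A * U = mat_diag n (\<lambda>i. es ! i)"
  using assms
proof (induction es arbitrary: n A)
  case Nil
  thus ?case by (intro bexI[of _ "1\<^sub>m 0"]) (auto simp: mat_diag_def)
next
  case (Cons e es)
  note A = Cons.prems(1) and sym = Cons.prems(2)
  define m where "m = length es"
  have n: "n = Suc m" using Cons.prems(4) by (simp add: m_def)
  have "eigenvalue A e"
    unfolding eigenvalue_root_char_poly[OF A] Cons.prems(3) by simp
  then obtain v where v: "v \<in> carrier_vec n" "v \<noteq> 0\<^sub>v n" "A *\<^sub>v v = e \<cdot>\<^sub>v v"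
    using A unfolding eigenvalue_def eigenvector_def by auto
  obtain W c where W: "W \<in> carrier_mat n n" and WW: "transpose_mat W * W = 1\<^sub>m n"
    and col: "col W 0 = c \<cdot>\<^sub>v v"
    using orthogonal_completion[OF v(1,2)] by blast
  let ?T = "transpose_mat W"
  have T: "?T \<in> carrier_mat n n" using W by simp
  have WW': "W * ?T = 1\<^sub>m n" by (rule mat_mult_left_right_inverse[OF T W WW])
  define A' where "A' = ?T * A * W"
  have A': "A' \<in> carrier_mat n n" using A T W by (simp add: A'_def)
  have symA': "transpose_mat A' = A'"
    unfolding A'_def using A T W sym
    by (simp add: transpose_mult[of _ n n _ n] assoc_mult_mat[of _ n n _ n _ n])
  have Aij: "A' $$ (i,j) = A' $$ (j,i)" if "i < n" "j < n" for i j
    using symA' that A' by (metis carrier_matD index_transpose_mat(1))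
  \<comment> \<open>The first column of \<open>W\<close> is still an eigenvector for
    \<open>e\<close>, so the first column of \<open>A'\<close> is \<open>e\<close> times the first
    column of \<open>?T * W\<close>, which is the identity.\<close>
  have col0: "A' $$ (i,0) = (if i = 0 then e else 0)" if i: "i < n" for i
  proof -
    have "A * W \<in> carrier_mat n n" using A W by simp
    hence "A' $$ (i,0) = col W i \<bullet> col (A * W) 0"
      unfolding A'_def using A W T i n by (simp add: assoc_mult_mat[of _ n n _ n _ n])
    also have "col (A * W) 0 = A *\<^sub>v col W 0" using A W n by (intro col_mult2[of _ n n _ n]) auto
    also have "\<dots> = e \<cdot>\<^sub>v col W 0"
      unfolding col using A v by (simp add: mult_mat_vec smult_smult_assoc mult.commute)
    also have "col W i \<bullet> \<dots> = e * (?T * W) $$ (i,0)" using W i n by simp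
    finally show ?thesis using i n by (simp add: WW)
  qed
  define A3 where "A3 = mat m m (\<lambda>(i,j). A' $$ (Suc i, Suc j))"
  let ?E = "mat 1 1 (\<lambda>_. e)"
  have A3: "A3 \<in> carrier_mat m m" by (simp add: A3_def)
  \<comment> \<open>The zeros in the first row are those of the first column, carried over by
    symmetry.\<close>
  have block: "A' = four_block_mat ?E (0\<^sub>m 1 m) (0\<^sub>m m 1) A3"
  proof (rule eq_matI)
    fix i j
    assume "i < dim_row (four_block_mat ?E (0\<^sub>m 1 m) (0\<^sub>m m 1) A3)"
      and "j < dim_col (four_block_mat ?E (0\<^sub>m 1 m) (0\<^sub>m m 1) A3)"
    hence ij: "i < n" "j < n" using A3 n by auto
    show "A' $$ (i,j) = four_block_mat ?E (0\<^sub>m 1 m) (0\<^sub>m m 1) A3 $$ (i,j)"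
      using ij A3 n col0[OF ij(1)] col0[OF ij(2)] Aij[OF ij]
      by (cases i; cases j) (auto simp: A3_def)
  qed (use A' A3 n in auto)
  have symA3: "transpose_mat A3 = A3"
    by (rule eq_matI) (auto simp: A3_def Aij n)
  have "similar_mat_wit A' A ?T W"
    by (rule similar_mat_witI[of _ _ n]) (use W T A A' WW WW' in \<open>auto simp: A'_def\<close>)
  hence "char_poly A' = char_poly A" using char_poly_similar unfolding similar_mat_def by blast
  also have "\<dots> = [:- e, 1:] * (\<Prod>e\<leftarrow>es. [:- e, 1:])" using Cons.prems(3) by simp
  also have "char_poly A' = char_poly ?E * char_poly A3"
    unfolding block by (rule char_poly_four_block_zeros_col[OF _ _ A3]) auto
  also have "char_poly ?E = [:- e, 1:]"
    by (simp add: char_poly_defs det_def sign_def)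
  \<comment> \<open>Cancelling the linear factor of \<open>e\<close> leaves exactly the factors that
    the induction hypothesis expects.\<close>
  finally have "char_poly A3 = (\<Prod>e\<leftarrow>es. [:- e, 1:])"
    by (metis mult_cancel_left pCons_eq_0_iff zero_neq_one)
  from Cons.IH[OF A3 symA3 this m_def[symmetric]] obtain V
    where V: "V \<in> carrier_mat m m" "transpose_mat V * V = 1\<^sub>m m"
      "transpose_mat V * A3 * V = mat_diag m (\<lambda>i. es ! i)" by blast
  \<comment> \<open>\<open>V'\<close> fixes the first coordinate and diagonalizes the rest, so
    \<open>W * V'\<close> is the required orthogonal matrix.\<close>
  define V' where "V' = four_block_mat (1\<^sub>m 1) (0\<^sub>m 1 m) (0\<^sub>m m 1) V"
  have V': "V' \<in> carrier_mat n n" unfolding V'_def by (rule carrier_matI) (use V(1) n in auto)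
  have tV': "transpose_mat V' = four_block_mat (1\<^sub>m 1) (0\<^sub>m 1 m) (0\<^sub>m m 1) (transpose_mat V)"
    unfolding V'_def using V(1) by (subst transpose_four_block_mat) auto
  have Vt: "transpose_mat V \<in> carrier_mat m m" using V(1) by simp
  have VV': "transpose_mat V' * V' = 1\<^sub>m n"
    unfolding tV' unfolding V'_def
    by (subst mult_four_block_mat[OF _ _ _ Vt _ _ _ V(1)]) (use V n in \<open>auto intro!: eq_matI\<close>)
  have "transpose_mat V' * A' * V' = four_block_mat ?E (0\<^sub>m 1 m) (0\<^sub>m m 1) (transpose_mat V * A3 * V)"
    unfolding tV' block unfolding V'_def
    using V(1) A3 Vt
    by (simp add: mult_four_block_mat[of _ 1 1 _ m _ m _ _ 1 _ m])
  also have "\<dots> = mat_diag n (\<lambda>i. (e # es) ! i)"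
    unfolding V(3) by (rule eq_matI) (auto simp: n mat_diag_def nth_Cons')
  finally have diag: "transpose_mat V' * A' * V' = mat_diag n (\<lambda>i. (e # es) ! i)" .
  let ?U = "W * V'"
  have tU: "transpose_mat ?U = transpose_mat V' * ?T" using W V' by (rule transpose_mult)
  have tV'c: "transpose_mat V' \<in> carrier_mat n n" using V' by simp
  note assoc = assoc_mult_mat[of _ n n _ n _ n]
  have "transpose_mat ?U * ?U = transpose_mat V' * ((?T * W) * V')"
    unfolding tU using W T V' tV'c by (simp add: assoc)
  also have "\<dots> = 1\<^sub>m n" using VV' V' by (simp add: WW)
  finally have UU: "transpose_mat ?U * ?U = 1\<^sub>m n" .
  have "transpose_mat ?U * A * ?U = transpose_mat V' * A' * V'"
    unfolding tU A'_def using W T V' tV'c A by (simp add: assoc)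
  with diag UU W V' show ?case by (intro bexI[of _ ?U]) auto
qed

section \<open>The sorted list of eigenvalues of a symmetric matrix\<close>

lemma proots_linear_factors: "proots (\<Prod>e\<leftarrow>es. [:- e, 1:]) = mset (es :: real list)"
proof (induction es)
  case (Cons e es)
  have "(\<Prod>e\<leftarrow>es. [:- e, 1:]) \<noteq> 0" by (auto simp: prod_list_zero_iff)
  \<comment> \<open>Multiplying out the linear factor would destroy the product to which
    \<open>proots_mult\<close> applies.\<close>
  thus ?case using Cons by (simp add: proots_mult del: mult_pCons_left)
qed simp

text \<open>\<open>eigenvalues_desc\<close> lists only the real roots. For a symmetric matrix the
  characteristic polynomial splits over the reals, so none is lost and the list has full
  length.\<close>

lemma eigenvalues_desc_symmetric:
  assumes A: "A \<in> carrier_mat n n" and sym: "transpose_mat A = A"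
  shows "char_poly A = (\<Prod>e\<leftarrow>eigenvalues_desc A. [:- e, 1:])"
    and "length (eigenvalues_desc A) = n"
    and "sorted_wrt (\<ge>) (eigenvalues_desc A)"
proof -
  obtain es where es: "char_poly A = (\<Prod>e\<leftarrow>es. [:- e, 1:])" "length es = n"
    using char_poly_symmetric_splits[OF A sym] by blast
  have m: "mset (eigenvalues_desc A) = mset es"
    unfolding eigenvalues_desc_def es(1) proots_linear_factors by simp
  show "length (eigenvalues_desc A) = n" using m es(2) by (metis size_mset)
  have "(\<Prod>e\<leftarrow>eigenvalues_desc A. [:- e, 1:]) = (\<Prod>e\<leftarrow>es. [:- e, 1:])"
    using m by (metis mset_map prod_mset_prod_list)
  thus "char_poly A = (\<Prod>e\<leftarrow>eigenvalues_desc A. [:- e, 1:])" using es(1) by simp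
  show "sorted_wrt (\<ge>) (eigenvalues_desc A)"
    unfolding eigenvalues_desc_def by (simp add: sorted_wrt_rev)
qed

section \<open>Rayleigh quotients in an orthonormal eigenbasis\<close>

lemma scalar_prod_self:
  fixes w :: "real vec"
  assumes "w \<in> carrier_vec n"
  shows "w \<bullet> w = (\<Sum>i<n. (w $ i)\<^sup>2)"
  using assms by (simp add: scalar_prod_def power2_eq_square atLeast0LessThan)

lemma mat_diag_mult_vec:
  fixes w :: "'a::comm_semiring_1 vec"
  assumes "w \<in> carrier_vec n"
  shows "mat_diag n d *\<^sub>v w = vec n (\<lambda>i. d i * w $ i)"
proof (rule eq_vecI)
  fix i assume "i < dim_vec (vec n (\<lambda>i. d i * w $ i))"
  hence i: "i < n" by simp
  have "(mat_diag n d *\<^sub>v w) $ i = (\<Sum>j<n. (if i = j then d j else 0) * w $ j)"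
    using i assms by (simp add: mat_diag_def scalar_prod_def atLeast0LessThan)
  also have "\<dots> = d i * w $ i"
    using i by (simp add: if_distrib[of "\<lambda>a. a * _"] cong: if_cong)
  finally show "(mat_diag n d *\<^sub>v w) $ i = vec n (\<lambda>i. d i * w $ i) $ i"
    using i by simp
qed (simp add: mat_diag_def)

text \<open>\<open>T\<close> is the transpose of a diagonalizing orthogonal matrix, so
  \<open>T *\<^sub>v x\<close> collects the coordinates of \<open>x\<close> in an orthonormal
  eigenbasis, ordered by decreasing eigenvalue.\<close>

lemma quadratic_form_diagonal:
  assumes A: "A \<in> carrier_mat n n" and sym: "transpose_mat A = A"
  obtains T :: "real mat" where "T \<in> carrier_mat n n"
    and "\<And>x. x \<in> carrier_vec n \<Longrightarrow> x \<bullet> x = (\<Sum>i<n. ((T *\<^sub>v x) $ i)\<^sup>2)"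
    and "\<And>x. x \<in> carrier_vec n \<Longrightarrow>
           x \<bullet> (A *\<^sub>v x) = (\<Sum>i<n. eigenvalues_desc A ! i * ((T *\<^sub>v x) $ i)\<^sup>2)"
proof -
  let ?es = "eigenvalues_desc A"
  let ?D = "mat_diag n (\<lambda>i. ?es ! i)"
  note ev = eigenvalues_desc_symmetric[OF A sym]
  obtain U where U: "U \<in> carrier_mat n n" "transpose_mat U * U = 1\<^sub>m n"
    "transpose_mat U * A * U = ?D"
    using symmetric_diagonalization[OF A sym ev(1,2)] by blast
  let ?T = "transpose_mat U"
  have T: "?T \<in> carrier_mat n n" using U(1) by simp
  have UT: "U * ?T = 1\<^sub>m n" by (rule mat_mult_left_right_inverse[OF T U(1,2)])
  note assoc = assoc_mult_mat[of _ n n _ n _ n]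
  have "U * ?D * ?T = (U * ?T) * A * (U * ?T)"
    unfolding U(3)[symmetric] using U(1) T A by (simp add: assoc)
  hence AD: "A = U * ?D * ?T" using A by (simp add: UT)
  show thesis
  proof (rule that[OF T])
    fix x :: "real vec" assume x: "x \<in> carrier_vec n"
    have c: "?T *\<^sub>v x \<in> carrier_vec n" using T x by simp
    have adj: "x \<bullet> (U *\<^sub>v w) = (?T *\<^sub>v x) \<bullet> w" if "w \<in> carrier_vec n" for w
      using transpose_vec_mult_scalar[OF U(1) that x] by simp
    have "x \<bullet> x = x \<bullet> (U *\<^sub>v (?T *\<^sub>v x))"
      using U(1) T x by (simp add: UT flip: assoc_mult_mat_vec)
    also have "\<dots> = (?T *\<^sub>v x) \<bullet> (?T *\<^sub>v x)" by (rule adj[OF c])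
    also note scalar_prod_self[OF c]
    finally show "x \<bullet> x = (\<Sum>i<n. ((?T *\<^sub>v x) $ i)\<^sup>2)" .
    have D: "?D \<in> carrier_mat n n" by simp
    note Dc = mat_diag_mult_vec[OF c]
    have "A *\<^sub>v x = U *\<^sub>v (?D *\<^sub>v (?T *\<^sub>v x))"
      using U(1) T D x by (subst AD) (simp add: assoc_mult_mat_vec[of _ n n _ n])
    hence "x \<bullet> (A *\<^sub>v x) = (?T *\<^sub>v x) \<bullet> (?D *\<^sub>v (?T *\<^sub>v x))"
      using adj[of "?D *\<^sub>v (?T *\<^sub>v x)"] Dc by simp
    thus "x \<bullet> (A *\<^sub>v x) = (\<Sum>i<n. ?es ! i * ((?T *\<^sub>v x) $ i)\<^sup>2)"
      unfolding Dc using c by (simp add: scalar_prod_def[of "?T *\<^sub>v x" "vec _ _"] power2_eq_square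
          atLeast0LessThan mult_ac)
  qed
qed

text \<open>In eigenbasis coordinates the form is a sum of squares weighted by the eigenvalues;
  replacing each weight by the largest one gives the bound.\<close>

lemma rayleigh_quotient_le_first_eigenvalue:
  assumes A: "A \<in> carrier_mat n n" and sym: "transpose_mat A = A"
    and y: "y \<in> carrier_vec n" and pos: "y \<bullet> y > 0"
    and R: "y \<bullet> (A *\<^sub>v y) = R * (y \<bullet> y)"
  shows "R \<le> nth_eigenvalue A 1"
proof -
  let ?es = "eigenvalues_desc A"
  obtain T where T: "T \<in> carrier_mat n n"
    and nrm: "\<And>x. x \<in> carrier_vec n \<Longrightarrow> x \<bullet> x = (\<Sum>i<n. ((T *\<^sub>v x) $ i)\<^sup>2)"
    and quad: "\<And>x. x \<in> carrier_vec n \<Longrightarrow>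
           x \<bullet> (A *\<^sub>v x) = (\<Sum>i<n. ?es ! i * ((T *\<^sub>v x) $ i)\<^sup>2)"
    using quadratic_form_diagonal[OF A sym] by blast
  note ev = eigenvalues_desc_symmetric[OF A sym]
  have "?es ! i \<le> ?es ! 0" if "i < n" for i
    using sorted_wrt_nth_less[OF ev(3), of 0 i] ev(2) that by (cases "i = 0") auto
  hence "(\<Sum>i<n. ?es ! i * ((T *\<^sub>v y) $ i)\<^sup>2) \<le> (\<Sum>i<n. ?es ! 0 * ((T *\<^sub>v y) $ i)\<^sup>2)"
    by (intro sum_mono mult_right_mono) auto
  hence "R * (y \<bullet> y) \<le> ?es ! 0 * (y \<bullet> y)"
    using R quad[OF y] nrm[OF y] by (simp add: sum_distrib_left)
  thus ?thesis using pos by (simp add: nth_eigenvalue_def)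
qed

text \<open>An instance of the Courant-Fischer principle: if the form is at most \<open>R\<close>
  times the squared norm on a plane, then the second smallest eigenvalue is at most
  \<open>R\<close>.\<close>

lemma penultimate_eigenvalue_le_rayleigh_quotient:
  assumes A: "A \<in> carrier_mat n n" and sym: "transpose_mat A = A" and n: "2 \<le> n"
    and z: "z \<in> carrier_vec n" and zpos: "z \<bullet> z > 0" and ker: "A *\<^sub>v z = 0\<^sub>v n"
    and y: "y \<in> carrier_vec n" and ypos: "y \<bullet> y > 0" and orth: "z \<bullet> y = 0"
    and R: "y \<bullet> (A *\<^sub>v y) = R * (y \<bullet> y)" and R0: "0 \<le> R"
  shows "nth_eigenvalue A (n - 1) \<le> R"
proof -
  let ?es = "eigenvalues_desc A"
  obtain T where T: "T \<in> carrier_mat n n"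
    and nrm: "\<And>x. x \<in> carrier_vec n \<Longrightarrow> x \<bullet> x = (\<Sum>i<n. ((T *\<^sub>v x) $ i)\<^sup>2)"
    and quad: "\<And>x. x \<in> carrier_vec n \<Longrightarrow>
           x \<bullet> (A *\<^sub>v x) = (\<Sum>i<n. ?es ! i * ((T *\<^sub>v x) $ i)\<^sup>2)"
    using quadratic_form_diagonal[OF A sym] by blast
  note ev = eigenvalues_desc_symmetric[OF A sym]
  \<comment> \<open>These are the coordinates along the eigenvector of the smallest eigenvalue.
    Their vanishing on a combination of \<open>z\<close> and \<open>y\<close> is one linear equation
    in two unknowns, hence has a nontrivial solution.\<close>
  define a b where "a = (T *\<^sub>v z) $ (n - 1)" and "b = (T *\<^sub>v y) $ (n - 1)"
  obtain \<alpha> \<beta> where ab: "\<alpha> * a + \<beta> * b = 0" "\<alpha> \<noteq> 0 \<or> \<beta> \<noteq> 0"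
  proof (cases "a = 0 \<and> b = 0")
    case False
    thus ?thesis using that[of b "- a"] by auto
  qed (use that[of 1 0] in auto)
  define x where "x = \<alpha> \<cdot>\<^sub>v z + \<beta> \<cdot>\<^sub>v y"
  have x: "x \<in> carrier_vec n" using y z by (simp add: x_def)
  have Tx: "T *\<^sub>v x = \<alpha> \<cdot>\<^sub>v (T *\<^sub>v z) + \<beta> \<cdot>\<^sub>v (T *\<^sub>v y)"
    using T y z by (simp add: x_def mult_add_distrib_mat_vec[of _ n n] mult_mat_vec)
  have last: "(T *\<^sub>v x) $ (n - 1) = 0"
    unfolding Tx using T n ab by (simp add: a_def b_def)
  have yz: "y \<bullet> z = 0" using orth comm_scalar_prod[OF y z] by simp
  have xx: "x \<bullet> x = \<alpha>\<^sup>2 * (z \<bullet> z) + \<beta>\<^sup>2 * (y \<bullet> y)"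
    unfolding x_def using y z orth yz
    by (simp add: add_scalar_prod_distrib[of _ n] scalar_prod_add_distrib[of _ n] power2_eq_square)
  have xpos: "x \<bullet> x > 0"
    using ab(2)
  proof
    assume "\<alpha> \<noteq> 0"
    thus ?thesis unfolding xx using zpos ypos by (intro add_pos_nonneg) auto
  next
    assume "\<beta> \<noteq> 0"
    thus ?thesis unfolding xx using zpos ypos by (intro add_nonneg_pos) auto
  qed
  have Ay: "A *\<^sub>v y \<in> carrier_vec n" using A y by simp
  \<comment> \<open>Symmetry moves \<open>A\<close> onto \<open>z\<close>, which it
    annihilates.\<close>
  have zAy: "z \<bullet> (A *\<^sub>v y) = 0"
    using transpose_vec_mult_scalar[OF A y z] y by (simp add: sym ker)
  have "\<alpha> \<cdot>\<^sub>v 0\<^sub>v n = 0\<^sub>v n" by (rule eq_vecI) auto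
  hence "A *\<^sub>v x = \<beta> \<cdot>\<^sub>v (A *\<^sub>v y)"
    using A y z Ay by (simp add: x_def mult_add_distrib_mat_vec[of _ n n] mult_mat_vec ker)
  hence "x \<bullet> (A *\<^sub>v x) = R * (\<beta>\<^sup>2 * (y \<bullet> y))"
    unfolding x_def using y z Ay zAy R
    by (simp add: add_scalar_prod_distrib[of _ n] power2_eq_square)
  \<comment> \<open>The component along \<open>z\<close> adds to the squared norm but not to the
    form, which is harmless as \<open>R\<close> is nonnegative.\<close>
  also have "\<dots> \<le> R * (x \<bullet> x)"
    unfolding xx using R0 zpos by (intro mult_left_mono) auto
  finally have le: "x \<bullet> (A *\<^sub>v x) \<le> R * (x \<bullet> x)" .
  \<comment> \<open>Counting from 0, position \<open>n - 2\<close> holds the second smallest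
    eigenvalue. Only position \<open>n - 1\<close> can hold a smaller one, and there the coordinate
    of \<open>x\<close> is zero.\<close>
  have "?es ! (n - 2) * ((T *\<^sub>v x) $ i)\<^sup>2 \<le> ?es ! i * ((T *\<^sub>v x) $ i)\<^sup>2" if "i < n" for i
  proof (cases "i = n - 1")
    case False
    hence "?es ! (n - 2) \<le> ?es ! i"
      using sorted_wrt_nth_less[OF ev(3), of i "n - 2"] ev(2) that n by (cases "i = n - 2") auto
    thus ?thesis by (intro mult_right_mono) auto
  qed (use last in simp)
  hence "?es ! (n - 2) * (x \<bullet> x) \<le> x \<bullet> (A *\<^sub>v x)"
    unfolding quad[OF x] nrm[OF x] sum_distrib_left by (intro sum_mono) auto
  with le have "?es ! (n - 2) * (x \<bullet> x) \<le> R * (x \<bullet> x)" by linarith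
  thus ?thesis using xpos by (simp add: nth_eigenvalue_def numeral_2_eq_2)
qed

section \<open>Finite sums and counting in multisets\<close>

lemma sum_lessThan_add:
  fixes f :: "nat \<Rightarrow> 'a::comm_monoid_add"
  shows "sum f {..<n + m} = sum f {..<n} + (\<Sum>j<m. f (n + j))"
  by (induction m) (simp_all add: add.assoc)

lemma sum_nth_distinct:
  assumes "distinct vs"
  shows "(\<Sum>i<length vs. f (vs ! i)) = (\<Sum>v\<in>set vs. f v)"
  using sum.reindex_bij_betw[OF bij_betw_nth[OF assms refl refl], of f] .

text \<open>Turns a degree into a row or column sum: \<open>g\<close> sends a vertex
  \<open>w\<close> to the edge or arc that joins a fixed vertex with \<open>w\<close>, and
  injectivity prevents double counting.\<close>

lemma size_filter_eq_sum_count: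
  assumes "finite V" "inj_on g V" "\<And>e. e \<in># M \<Longrightarrow> P e \<longleftrightarrow> e \<in> g ` V"
  shows "size {#e \<in># M. P e#} = (\<Sum>w\<in>V. count M (g w))"
proof -
  have "{#e \<in># M. P e#} = {#e \<in># M. e \<in> g ` V#}"
    using assms(3) by (intro filter_mset_cong) auto
  \<comment> \<open>Members of the image that do not occur in \<open>M\<close> contribute
    zero.\<close>
  hence "size {#e \<in># M. P e#} = (\<Sum>e\<in>g ` V. count {#e \<in># M. e \<in> g ` V#} e)"
    using assms(1)
    by (simp add: size_multiset_overloaded_eq)
      (intro sum.mono_neutral_left; auto simp: count_eq_zero_iff)
  also have "\<dots> = (\<Sum>w\<in>V. count M (g w))"
    using assms(2) by (simp add: sum.reindex)
  finally show ?thesis .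
qed

text \<open>Every element lies in exactly one fibre of \<open>f\<close>. With \<open>fst\<close> and
  \<open>snd\<close> for \<open>f\<close>, this says that the outdegrees and the indegrees each sum
  to the number of arcs.\<close>

lemma sum_fibre_sizes:
  assumes "finite V" "\<And>e. e \<in># M \<Longrightarrow> f e \<in> V"
  shows "(\<Sum>v\<in>V. size {#e \<in># M. f e = v#}) = size M"
  using assms(2)
proof (induction M)
  case (add e M)
  have "(\<Sum>v\<in>V. size {#e' \<in># add_mset e M. f e' = v#})
      = (\<Sum>v\<in>V. size {#e \<in># M. f e = v#} + (if f e = v then 1 else 0))"
    by (rule sum.cong) auto
  thus ?case using add assms(1) by (simp add: sum.distrib)
qed simp

section \<open>The integrated Laplacian: symmetry, row sums and action on blockwise constant
  vectors\<close>

lemma integrated_laplacian_carrier: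
  "integrated_laplacian G vs \<in> carrier_mat (2 * length vs) (2 * length vs)"
  by (rule carrier_matI)
    (simp_all add: integrated_laplacian_def integrated_adjacency_def edge_matrix_def arc_matrix_def)

lemmas integrated_laplacian_entries =
  integrated_laplacian_def integrated_degree_def integrated_adjacency_def
  edge_matrix_def arc_matrix_def mat_diag_def Let_def

lemma integrated_laplacian_symmetric:
  fixes G :: "'v mixed_graph"
  shows "transpose_mat (integrated_laplacian G vs) = integrated_laplacian G vs"
proof -
  have comm: "Upair u w = Upair w u" for u w :: 'v by simp
  show ?thesis by (rule eq_matI) (auto simp: integrated_laplacian_entries comm)
qed

context
  fixes G :: "'v mixed_graph" and vs :: "'v list"
  assumes G: "is_mixed_graph G" and vs: "distinct vs" "set vs = vertices G"
begin

lemma edge_matrix_row_sum: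
  assumes i: "i < length vs"
  shows "(\<Sum>j<length vs. edge_matrix G vs $$ (i,j)) = real (degree_edges G (vs ! i))"
proof -
  let ?v = "vs ! i" and ?V = "set vs"
  let ?c = "\<lambda>w. real (count (edges G) (Upair ?v w))"
  \<comment> \<open>The doubled diagonal entry is split into the ordinary count of the loops and one
    extra copy, matching the two summands of \<open>degree_edges\<close>.\<close>
  have "(\<Sum>j<length vs. edge_matrix G vs $$ (i,j))
      = (\<Sum>j<length vs. ?c (vs ! j) + (if i = j then ?c (vs ! j) else 0))"
    by (rule sum.cong) (auto simp: edge_matrix_def i)
  also have "\<dots> = (\<Sum>w\<in>?V. ?c w) + ?c ?v"
    using i by (simp add: sum.distrib sum_nth_distinct[OF vs(1), of ?c])
  also have "(\<Sum>w\<in>?V. ?c w) = real (size {#e \<in># edges G. ?v \<in> set_uprod e#})"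
  proof (subst size_filter_eq_sum_count[of ?V "Upair ?v"])
    fix e assume "e \<in># edges G"
    hence "set_uprod e \<subseteq> ?V" using G vs(2) by (auto simp: is_mixed_graph_def)
    thus "?v \<in> set_uprod e \<longleftrightarrow> e \<in> Upair ?v ` ?V"
      by (cases e) (auto simp: image_iff)
  qed (auto simp: inj_on_def)
  finally show ?thesis by (simp add: degree_edges_def)
qed

lemma arc_matrix_row_sum:
  assumes i: "i < length vs"
  shows "(\<Sum>j<length vs. arc_matrix G vs $$ (i,j)) = real (outdegree G (vs ! i))"
proof -
  have "(\<Sum>j<length vs. arc_matrix G vs $$ (i,j))
      = (\<Sum>w\<in>set vs. real (count (arcs G) (vs ! i, w)))"
    unfolding sum_nth_distinct[OF vs(1), symmetric] by (simp add: arc_matrix_def i)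
  also have "\<dots> = real (outdegree G (vs ! i))"
    unfolding outdegree_def
    by (subst size_filter_eq_sum_count[of "set vs" "Pair (vs ! i)"])
      (use G vs(2) in \<open>auto simp: is_mixed_graph_def inj_on_def\<close>)
  finally show ?thesis .
qed

lemma arc_matrix_column_sum:
  assumes i: "i < length vs"
  shows "(\<Sum>j<length vs. arc_matrix G vs $$ (j,i)) = real (indegree G (vs ! i))"
proof -
  have "(\<Sum>j<length vs. arc_matrix G vs $$ (j,i))
      = (\<Sum>w\<in>set vs. real (count (arcs G) (w, vs ! i)))"
    unfolding sum_nth_distinct[OF vs(1), symmetric] by (simp add: arc_matrix_def i)
  also have "\<dots> = real (indegree G (vs ! i))"
    unfolding indegree_def
    by (subst size_filter_eq_sum_count[of "set vs" "\<lambda>w. (w, vs ! i)"])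
      (use G vs(2) in \<open>auto simp: is_mixed_graph_def inj_on_def\<close>)
  finally show ?thesis .
qed

lemma sum_outdegree: "(\<Sum>i<length vs. real (outdegree G (vs ! i))) = real (num_arcs G)"
proof -
  have "(\<Sum>v\<in>set vs. outdegree G v) = num_arcs G"
    unfolding outdegree_def num_arcs_def
    by (rule sum_fibre_sizes) (use G vs(2) in \<open>auto simp: is_mixed_graph_def\<close>)
  thus ?thesis by (simp add: sum_nth_distinct[OF vs(1)] flip: of_nat_sum)
qed

lemma sum_indegree: "(\<Sum>i<length vs. real (indegree G (vs ! i))) = real (num_arcs G)"
proof -
  have "(\<Sum>v\<in>set vs. indegree G v) = num_arcs G"
    unfolding indegree_def num_arcs_def
    by (rule sum_fibre_sizes) (use G vs(2) in \<open>auto simp: is_mixed_graph_def\<close>)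
  thus ?thesis by (simp add: sum_nth_distinct[OF vs(1)] flip: of_nat_sum)
qed

text \<open>In each row the edge entries cancel against the edge part of the degree. What remains is
  the out- or indegree on the diagonal against the same number of arcs in the other block, hence the
  factor \<open>a - b\<close> or \<open>b - a\<close>.\<close>

lemma integrated_laplacian_mult_blockwise_const:
  defines "n \<equiv> length vs"
  shows "integrated_laplacian G vs *\<^sub>v vec (2 * n) (\<lambda>i. if i < n then a else b) =
    vec (2 * n) (\<lambda>i. if i < n then (a - b) * real (outdegree G (vs ! i))
                             else (b - a) * real (indegree G (vs ! (i - n))))"
    (is "?L *\<^sub>v ?x = ?r")
proof (rule eq_vecI)
  fix i assume "i < dim_vec ?r"
  hence i: "i < 2 * n" by simp
  have L: "?L \<in> carrier_mat (2 * n) (2 * n)" unfolding n_def by (rule integrated_laplacian_carrier)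
  have split: "(\<Sum>j<2 * n. f j) = (\<Sum>j<n. f j) + (\<Sum>j<n. f (n + j))" for f :: "nat \<Rightarrow> real"
    using sum_lessThan_add[of f n n] by (simp add: mult_2)
  have "(?L *\<^sub>v ?x) $ i = (\<Sum>j<2 * n. ?L $$ (i,j) * (if j < n then a else b))"
    using i L by (simp add: scalar_prod_def atLeast0LessThan)
  also have "\<dots> = (\<Sum>j<n. ?L $$ (i,j)) * a + (\<Sum>j<n. ?L $$ (i,n + j)) * b"
    by (simp add: split sum_distrib_right)
  also have "\<dots> = ?r $ i"
  proof (cases "i < n")
    case True
    have "(\<Sum>j<n. ?L $$ (i,j)) =
        (\<Sum>j<n. (if i = j then real (degree_edges G (vs ! i) + outdegree G (vs ! i)) else 0)
                 - edge_matrix G vs $$ (i,j))"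
      by (rule sum.cong) (use True in \<open>auto simp: integrated_laplacian_entries n_def\<close>)
    also have "\<dots> = real (outdegree G (vs ! i))"
      using True by (simp add: sum_subtractf n_def edge_matrix_row_sum)
    finally have 1: "(\<Sum>j<n. ?L $$ (i,j)) = real (outdegree G (vs ! i))" .
    have "(\<Sum>j<n. ?L $$ (i,n + j)) = (\<Sum>j<n. - arc_matrix G vs $$ (i,j))"
      by (rule sum.cong) (use True in \<open>auto simp: integrated_laplacian_entries n_def\<close>)
    also have "\<dots> = - real (outdegree G (vs ! i))"
      using True by (simp add: sum_negf n_def arc_matrix_row_sum)
    finally show ?thesis using 1 True i by (simp add: algebra_simps)
  next
    case False
    define k where "k = i - n"
    have k: "i = n + k" "k < n" using False i by (auto simp: k_def)
    have "(\<Sum>j<n. ?L $$ (i,n + j)) =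
        (\<Sum>j<n. (if k = j then real (degree_edges G (vs ! k) + indegree G (vs ! k)) else 0)
                 - edge_matrix G vs $$ (k,j))"
      by (rule sum.cong) (use k in \<open>auto simp: integrated_laplacian_entries n_def\<close>)
    also have "\<dots> = real (indegree G (vs ! k))"
      using k by (simp add: sum_subtractf n_def edge_matrix_row_sum)
    finally have 1: "(\<Sum>j<n. ?L $$ (i,n + j)) = real (indegree G (vs ! k))" .
    have "(\<Sum>j<n. ?L $$ (i,j)) = (\<Sum>j<n. - arc_matrix G vs $$ (j,k))"
      by (rule sum.cong) (use k in \<open>auto simp: integrated_laplacian_entries n_def\<close>)
    also have "\<dots> = - real (indegree G (vs ! k))"
      using k by (simp add: sum_negf n_def arc_matrix_column_sum)
    finally show ?thesis using 1 k i by (simp add: algebra_simps)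
  qed
  finally show "(?L *\<^sub>v ?x) $ i = ?r $ i" .
qed (use integrated_laplacian_carrier[of G vs] in \<open>auto simp: n_def\<close>)

end

section \<open>Bounds on the spectrum of the integrated Laplacian\<close>

theorem theorem3p11:
  fixes G :: "'v mixed_graph" and vs :: "'v list" and n :: nat
  assumes "is_mixed_graph G"
    and "n = card (vertices G)" and "n \<ge> 1"
    and "distinct vs" and "set vs = vertices G"
  shows "laplacian_eigenvalue G vs (2 * n - 1) \<le> 2 * real (num_arcs G) / real n
       \<and> 2 * real (num_arcs G) / real n \<le> laplacian_eigenvalue G vs 1"
proof -
  note G = assms(1,4,5)
  have n: "n = length vs" using assms(2,4,5) distinct_card by metis
  let ?L = "integrated_laplacian G vs" and ?R = "2 * real (num_arcs G) / real n"
  have L: "?L \<in> carrier_mat (2 * n) (2 * n)" unfolding n by (rule integrated_laplacian_carrier)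
  note sym = integrated_laplacian_symmetric[of G vs]
  \<comment> \<open>One family covers both test vectors: \<open>b 1\<close> is the all-ones vector
    and \<open>b (-1)\<close> changes sign on the second block.\<close>
  define b where "b s = vec (2 * n) (\<lambda>i. if i < n then 1 else s)" for s :: real
  have b: "b s \<in> carrier_vec (2 * n)" for s by (simp add: b_def)
  have split: "(\<Sum>j<2 * n. f j) = (\<Sum>j<n. f j) + (\<Sum>j<n. f (n + j))" for f :: "nat \<Rightarrow> real"
    using sum_lessThan_add[of f n n] by (simp add: mult_2)
  have prod: "b s \<bullet> b t = real n * (1 + s * t)" for s t
    by (simp add: b_def scalar_prod_def atLeast0LessThan split) (simp add: algebra_simps)
  have ker: "?L *\<^sub>v b 1 = 0\<^sub>v (2 * n)"
    using integrated_laplacian_mult_blockwise_const[OF G, of 1 1]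
    by (auto simp: b_def n intro!: eq_vecI)
  have "b (-1) \<bullet> (?L *\<^sub>v b (-1)) =
      2 * (\<Sum>i<n. real (outdegree G (vs ! i))) + 2 * (\<Sum>i<n. real (indegree G (vs ! i)))"
    unfolding b_def n integrated_laplacian_mult_blockwise_const[OF G]
    by (simp add: scalar_prod_def atLeast0LessThan split[unfolded n] sum_distrib_left)
  \<comment> \<open>Both degree sums equal the number of arcs and
    \<open>b (-1) \<bullet> b (-1)\<close> is \<open>2 * n\<close>; \<open>n\<close> is nonzero, so
    it cancels against the denominator of \<open>?R\<close>.\<close>
  also have "\<dots> = ?R * (b (-1) \<bullet> b (-1))"
    using assms(3) unfolding prod by (auto simp: n sum_outdegree[OF G] sum_indegree[OF G])
  finally have R: "b (-1) \<bullet> (?L *\<^sub>v b (-1)) = ?R * (b (-1) \<bullet> b (-1))" .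
  have pos: "b (-1) \<bullet> b (-1) > 0" "b 1 \<bullet> b 1 > 0" and orth: "b 1 \<bullet> b (-1) = 0"
    using assms(3) by (simp_all add: prod)
  show ?thesis unfolding laplacian_eigenvalue_def
    using rayleigh_quotient_le_first_eigenvalue[OF L sym b pos(1) R]
      penultimate_eigenvalue_le_rayleigh_quotient[OF L sym _ b pos(2) ker b pos(1) orth R] assms(3)
    by simp
qed

end
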